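(* There exists an instance of the maintenance scheduling problem with storage ($W\neq\varnothing$) and integer input data (all capacities $u_x$, all processing times $p_a$, release times $r_a$, deadlines $d_a$, and the time horizon $T$ are integers) for which no optimal solution is integral, i.e. no optimal solution $t^*=(t^*_a)_{a\in A_1}$ of $\varphi^*=\max\{\operatorname{val}(t^* ) : t^*\in X\}$ satisfies $t^*_a\in\mathbb{Z}$ for all $a\in A_1$.
   Context: The maintenance scheduling problem. $N=(V,A,s,t)$ is a finite directed network (parallel arcs allowed) with distinct source $s$ and sink $t$; $\delta^{\text{out}}(v)$ and $\delta^{\text{in}}(v)$ are the sets of arcs starting, respectively ending, at $v$. $W\subseteq V\setminus\{s,t\}$ is a set of storage nodes, and $u=(u_x)_{x\in A\cup W}$ are nonnegative capacities (flow per unit time for arcs, stored amount for nodes in $W$). $T>0$ is the time horizon. $A_1\subseteq A$ is the set of arcs with a maintenance job; each $a\in A_1$ has exactly one job, with processing time $p_a>0$, release time $r_a$ and deadline $d_a$, where $0\leqslant r_a\leqslant d_a-p_a$ and $d_a\leqslant T$. A feasible solution is a start time vector $t^*=(t^*_a)_{a\in A_1}\in X:=\prod_{a\in A_1}[r_a,d_a-p_a]$. Value of a solution. Given $t^*\in X$, let $0=t_0<t_1<\cdots<t_n=T$ be the increasing enumeration of the set $\{t^*_a : a\in A_1\}\cup\{t^*_a+p_a : a\in A_1\}\cup\{0,T\}$, and for $a\in A_1$ let $I_a=\{i\in\{1,\dots,n\} : t^*_a<t_i\leqslant t^*_a+p_a\}$. Then $\operatorname{val}(t^* )$ is the maximum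 of $\sum_{i=1}^n\big(\sum_{a\in\delta^{\text{out}}(s)}x_{ai}-\sum_{a\in\delta^{\text{in}}(s)}x_{ai}\big)$ over all nonnegative reals $x_{ai}$ ($a\in A$, $1\leqslant i\leqslant n$) and $x_{vi}$ ($v\in W$, $0\leqslant i\leqslant n$) satisfying: $\sum_{a\in\delta^{\text{out}}(v)}x_{ai}=\sum_{a\in\delta^{\text{in}}(v)}x_{ai}$ for $v\in V\setminus(W\cup\{s,t\})$, $1\leqslant i\leqslant n$; $\sum_{a\in\delta^{\text{out}}(v)}x_{ai}+x_{vi}=\sum_{a\in\delta^{\text{in}}(v)}x_{ai}+x_{v,i-1}$ for $v\in W$, $1\leqslant i\leqslant n$; $x_{ai}\leqslant(t_i-t_{i-1})u_a$ for $a\in A\setminus A_1$ and all $i$, and for $a\in A_1$ and $i\notin I_a$; $x_{ai}=0$ for $a\in A_1$, $i\in I_a$; $x_{vi}\leqslant u_v$ for $v\in W$, $0\leqslant i\leqslant n$; $x_{v0}=x_{vn}=0$ for $v\in W$. The problem is to determine $\varphi^*=\max\{\operatorname{val}(t^* ) : t^*\in X\}$; an optimal solution is a $t^*\in X$ attaining this maximum. *)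

theory Defs
  imports Complex_Main "HOL-Library.FuncSet" "Graph_Theory.Digraph"
begin

text \<open>
  An instance of the maintenance scheduling problem. The capacity vector \<open>u\<close>, indexed by arcs and
  storage nodes, is split into \<open>arc_cap\<close> and \<open>store_cap\<close>.
\<close>

record ('v, 'a) maint_instance =
  graph :: "('v, 'a) pre_digraph"
  source :: 'v
  sink :: 'v
  storage :: "'v set"
  arc_cap :: "'a \<Rightarrow> real"
  store_cap :: "'v \<Rightarrow> real"
  horizon :: real
  job_arcs :: "'a set"
  proc :: "'a \<Rightarrow> real"
  release :: "'a \<Rightarrow> real"
  deadline :: "'a \<Rightarrow> real"

locale maintenance_problem =
  fin_digraph "graph N" for N :: "('v, 'a) maint_instance" +
  assumes source_in: "source N \<in> verts (graph N)"
    and sink_in: "sink N \<in> verts (graph N)"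
    and source_neq_sink: "source N \<noteq> sink N"
    and storage_sub: "storage N \<subseteq> verts (graph N) - {source N, sink N}"
    and arc_cap_nonneg: "\<And>a. a \<in> arcs (graph N) \<Longrightarrow> 0 \<le> arc_cap N a"
    and store_cap_nonneg: "\<And>v. v \<in> storage N \<Longrightarrow> 0 \<le> store_cap N v"
    and horizon_pos: "0 < horizon N"
    and job_arcs_sub: "job_arcs N \<subseteq> arcs (graph N)"
    and proc_pos: "\<And>a. a \<in> job_arcs N \<Longrightarrow> 0 < proc N a"
    and release_nonneg: "\<And>a. a \<in> job_arcs N \<Longrightarrow> 0 \<le> release N a"
    and release_le: "\<And>a. a \<in> job_arcs N \<Longrightarrow> release N a \<le> deadline N a - proc N a"
    and deadline_le: "\<And>a. a \<in> job_arcs N \<Longrightarrow> deadline N a \<le> horizon N"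

definition integer_data :: "('v, 'a) maint_instance \<Rightarrow> bool" where
  "integer_data N \<longleftrightarrow>
     (\<forall>a \<in> arcs (graph N). arc_cap N a \<in> \<int>) \<and>
     (\<forall>v \<in> storage N. store_cap N v \<in> \<int>) \<and>
     (\<forall>a \<in> job_arcs N. proc N a \<in> \<int> \<and> release N a \<in> \<int> \<and> deadline N a \<in> \<int>) \<and>
     horizon N \<in> \<int>"

definition start_vectors :: "('v, 'a) maint_instance \<Rightarrow> ('a \<Rightarrow> real) set" where
  "start_vectors N = (\<Pi>\<^sub>E a \<in> job_arcs N. {release N a .. deadline N a - proc N a})"

definition break_points :: "('v, 'a) maint_instance \<Rightarrow> ('a \<Rightarrow> real) \<Rightarrow> real set" where
  "break_points N ts =
     ts ` job_arcs N \<union> (\<lambda>a. ts a + proc N a) ` job_arcs N \<union> {0, horizon N}"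

definition num_periods :: "('v, 'a) maint_instance \<Rightarrow> ('a \<Rightarrow> real) \<Rightarrow> nat" where
  "num_periods N ts = card (break_points N ts) - 1"

definition break_time :: "('v, 'a) maint_instance \<Rightarrow> ('a \<Rightarrow> real) \<Rightarrow> nat \<Rightarrow> real" where
  "break_time N ts i = sorted_list_of_set (break_points N ts) ! i"

definition maint_periods :: "('v, 'a) maint_instance \<Rightarrow> ('a \<Rightarrow> real) \<Rightarrow> 'a \<Rightarrow> nat set" where
  "maint_periods N ts a =
     {i \<in> {1..num_periods N ts}.
        ts a < break_time N ts i \<and> break_time N ts i \<le> ts a + proc N a}"

text \<open>
  \<open>x a i\<close> is the flow on arc \<open>a\<close> during period \<open>i\<close>, and \<open>y v i\<close> is the amount stored at \<open>v\<close> at the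
  end of period \<open>i\<close> (the variable \<open>x\<^sub>v\<^sub>i\<close> of the linear program). Values of \<open>x\<close> and \<open>y\<close> outside the
  index ranges of the program are unconstrained and do not affect the objective.
\<close>

definition feasible_flow ::
  "('v, 'a) maint_instance \<Rightarrow> ('a \<Rightarrow> real) \<Rightarrow> ('a \<Rightarrow> nat \<Rightarrow> real) \<Rightarrow> ('v \<Rightarrow> nat \<Rightarrow> real) \<Rightarrow> bool" where
  "feasible_flow N ts x y \<longleftrightarrow>
     (let G = graph N; n = num_periods N ts; \<tau> = break_time N ts in
      (\<forall>a \<in> arcs G. \<forall>i \<in> {1..n}. 0 \<le> x a i) \<and>
      (\<forall>v \<in> storage N. \<forall>i \<in> {0..n}. 0 \<le> y v i) \<and>
      (\<forall>v \<in> verts G - (storage N \<union> {source N, sink N}). \<forall>i \<in> {1..n}.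
         (\<Sum>a \<in> out_arcs G v. x a i) = (\<Sum>a \<in> in_arcs G v. x a i)) \<and>
      (\<forall>v \<in> storage N. \<forall>i \<in> {1..n}.
         (\<Sum>a \<in> out_arcs G v. x a i) + y v i = (\<Sum>a \<in> in_arcs G v. x a i) + y v (i - 1)) \<and>
      (\<forall>a \<in> arcs G - job_arcs N. \<forall>i \<in> {1..n}. x a i \<le> (\<tau> i - \<tau> (i - 1)) * arc_cap N a) \<and>
      (\<forall>a \<in> job_arcs N. \<forall>i \<in> {1..n} - maint_periods N ts a.
         x a i \<le> (\<tau> i - \<tau> (i - 1)) * arc_cap N a) \<and>
      (\<forall>a \<in> job_arcs N. \<forall>i \<in> maint_periods N ts a. x a i = 0) \<and>
      (\<forall>v \<in> storage N. \<forall>i \<in> {0..n}. y v i \<le> store_cap N v) \<and>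
      (\<forall>v \<in> storage N. y v 0 = 0 \<and> y v n = 0))"

definition flow_value ::
  "('v, 'a) maint_instance \<Rightarrow> ('a \<Rightarrow> real) \<Rightarrow> ('a \<Rightarrow> nat \<Rightarrow> real) \<Rightarrow> real" where
  "flow_value N ts x =
     (\<Sum>i \<in> {1..num_periods N ts}.
        (\<Sum>a \<in> out_arcs (graph N) (source N). x a i) - (\<Sum>a \<in> in_arcs (graph N) (source N). x a i))"

text \<open>
  The maximum of a linear program that is feasible (zero flow) and bounded, so the greatest
  element exists for every start vector in \<open>start_vectors N\<close>.
\<close>

definition val :: "('v, 'a) maint_instance \<Rightarrow> ('a \<Rightarrow> real) \<Rightarrow> real" where
  "val N ts = (GREATEST z. \<exists>x y. feasible_flow N ts x y \<and> z = flow_value N ts x)"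

definition optimal_solution :: "('v, 'a) maint_instance \<Rightarrow> ('a \<Rightarrow> real) \<Rightarrow> bool" where
  "optimal_solution N ts \<longleftrightarrow>
     ts \<in> start_vectors N \<and> (\<forall>ts' \<in> start_vectors N. val N ts' \<le> val N ts)"

definition integral_solution :: "('v, 'a) maint_instance \<Rightarrow> ('a \<Rightarrow> real) \<Rightarrow> bool" where
  "integral_solution N ts \<longleftrightarrow> (\<forall>a \<in> job_arcs N. ts a \<in> \<int>)"

end

(*
  A storage node v of capacity 2 is fed by an arc of capacity 5 from the source, which needs an
  outage [t, t + 1] with 0 \<le> t \<le> 1, and is emptied into the sink at rate at most 1 during [0, 1]
  and at most 3 during [1, 2] (a job forced to start at time 0 closes an arc of capacity 2).
  The earlier the outage, the less can be stored before it starts; the later the outage, the more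
  of the fast period has to be served from the store. The inflow is at most 5t before the outage,
  and also at most t + 2, the outflow of that period plus the store; after the outage it is at most
  3(1 - t). Both bounds are attained, so the value is min (3 + 2t) (5 - 2t), with its only maximum
  at t = 1/2.
*)
theory Submission
  imports Defs
begin

definition outage_instance :: "(nat, nat) maint_instance" where
  "outage_instance =
     \<lparr> graph = \<lparr> verts = {0, 1, 2}, arcs = {0, 1, 2},
         tail = (\<lambda>a. if a = 0 then 0 else 2), head = (\<lambda>a. if a = 0 then 2 else 1) \<rparr>,
       source = 0, sink = 1, storage = {2},
       arc_cap = (\<lambda>a. if a = 0 then 5 else if a = 1 then 1 else 2), store_cap = (\<lambda>_. 2),
       horizon = 2, job_arcs = {0, 2}, proc = (\<lambda>_. 1), release = (\<lambda>_. 0),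
       deadline = (\<lambda>a. if a = 0 then 2 else 1) \<rparr>"

lemma outage_instance_sel [simp]:
  "verts (graph outage_instance) = {0, 1, 2}"
  "arcs (graph outage_instance) = {0, 1, 2}"
  "tail (graph outage_instance) = (\<lambda>a. if a = 0 then 0 else 2)"
  "head (graph outage_instance) = (\<lambda>a. if a = 0 then 2 else 1)"
  "source outage_instance = 0"
  "sink outage_instance = 1"
  "storage outage_instance = {2}"
  "arc_cap outage_instance = (\<lambda>a. if a = 0 then 5 else if a = 1 then 1 else 2)"
  "store_cap outage_instance = (\<lambda>_. 2)"
  "horizon outage_instance = 2"
  "job_arcs outage_instance = {0, 2}"
  "proc outage_instance = (\<lambda>_. 1)"
  "release outage_instance = (\<lambda>_. 0)"
  "deadline outage_instance = (\<lambda>a. if a = 0 then 2 else 1)"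
  by (simp_all add: outage_instance_def)

lemma outage_instance_incidence [simp]:
  "out_arcs (graph outage_instance) 0 = {0}"
  "in_arcs (graph outage_instance) 0 = {}"
  "out_arcs (graph outage_instance) 2 = {1, 2}"
  "in_arcs (graph outage_instance) 2 = {0}"
  by (auto simp: out_arcs_def in_arcs_def split: if_splits)

lemma maintenance_problem_outage_instance: "maintenance_problem outage_instance"
  by unfold_locales (auto split: if_splits)

lemma integer_data_outage_instance: "integer_data outage_instance"
  by (simp add: integer_data_def)

text \<open>The window of arc \<open>2\<close> is a single point, so \<open>ts 0\<close> is the only
  degree of freedom.\<close>

lemma start_vectors_outage_instance:
  "ts \<in> start_vectors outage_instance \<longleftrightarrow>
     0 \<le> ts 0 \<and> ts 0 \<le> 1 \<and> ts 2 = 0 \<and> ts \<in> extensional {0, 2}"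
  by (auto simp: start_vectors_def PiE_iff)

lemma periods_of_sorted_break_points:
  assumes "break_points N ts = set xs" "sorted xs" "distinct xs"
  shows "num_periods N ts = length xs - 1" "break_time N ts = (!) xs"
  using assms
  by (simp_all add: num_periods_def break_time_def distinct_card
      sorted_list_of_set.idem_if_sorted_distinct fun_eq_iff)

text \<open>An explicit flow together with a matching upper bound fixes the \<open>GREATEST\<close>,
  so no separate existence argument for the maximum is needed.\<close>

lemma val_eqI:
  assumes "feasible_flow N ts x y" "flow_value N ts x = z"
    and "\<And>x y. feasible_flow N ts x y \<Longrightarrow> flow_value N ts x \<le> z"
  shows "val N ts = z"
  unfolding val_def using assms by (intro Greatest_equality) auto

lemma atLeastAtMost_1_2_4: "{1..2::nat} = {1, 2}" "{0..2::nat} = {0, 1, 2}"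
  "{1..4::nat} = {1, 2, 3, 4}" "{0..4::nat} = {0, 1, 2, 3, 4}"
  by auto

text \<open>For an outage starting at 0 or 1, break points of the generic enumeration coincide and
  only two periods remain, so these end points are treated apart.\<close>

lemma val_outage_start_0:
  assumes "ts 0 = 0" "ts 2 = 0"
  shows "val outage_instance ts = 3"
proof -
  let ?N = outage_instance
  have bp: "break_points ?N ts = set [0, 1, 2]"
    using assms by (auto simp: break_points_def)
  have np: "num_periods ?N ts = 2" and bt: "break_time ?N ts = (!) [0, 1, 2]"
    using periods_of_sorted_break_points[OF bp] by (simp_all add: numeral_2_eq_2)
  have mp: "maint_periods ?N ts 0 = {1}" "maint_periods ?N ts 2 = {1}"
    using assms unfolding maint_periods_def np bt atLeastAtMost_1_2_4 by auto
  note ff = feasible_flow_def Let_def np bt atLeastAtMost_1_2_4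
  note fv = flow_value_def np atLeastAtMost_1_2_4
  \<comment> \<open>One row per arc; the leading 0 of each row is a dummy, since periods are counted
    from 1.\<close>
  define x :: "nat \<Rightarrow> nat \<Rightarrow> real" where "x = (\<lambda>a. (!) ([[0,0,3], [0,0,1], [0,0,2]] ! a))"
  show ?thesis
  proof (rule val_eqI)
    show "feasible_flow ?N ts x (\<lambda>_ _. 0)"
      unfolding ff by (auto simp: x_def mp)
    show "flow_value ?N ts x = 3"
      unfolding fv by (simp add: x_def)
  next
    fix x y assume "feasible_flow ?N ts x y"
    then show "flow_value ?N ts x \<le> 3"
      unfolding ff fv by (simp add: mp insert_Diff_if)
  qed
qed

lemma val_outage_start_1:
  assumes "ts 0 = 1" "ts 2 = 0"
  shows "val outage_instance ts = 3"
proof -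
  let ?N = outage_instance
  have bp: "break_points ?N ts = set [0, 1, 2]"
    using assms by (auto simp: break_points_def)
  have np: "num_periods ?N ts = 2" and bt: "break_time ?N ts = (!) [0, 1, 2]"
    using periods_of_sorted_break_points[OF bp] by (simp_all add: numeral_2_eq_2)
  have mp: "maint_periods ?N ts 0 = {2}" "maint_periods ?N ts 2 = {1}"
    using assms unfolding maint_periods_def np bt atLeastAtMost_1_2_4 by auto
  note ff = feasible_flow_def Let_def np bt atLeastAtMost_1_2_4
  note fv = flow_value_def np atLeastAtMost_1_2_4
  \<comment> \<open>The store is filled in period 1 and emptied in period 2, split 1:2 in proportion
    to the two outgoing capacities.\<close>
  define x :: "nat \<Rightarrow> nat \<Rightarrow> real" where "x = (\<lambda>a. (!) ([[0,3,0], [0,1,2/3], [0,0,4/3]] ! a))"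
  define y :: "nat \<Rightarrow> nat \<Rightarrow> real" where "y = (\<lambda>_. (!) [0,2,0])"
  show ?thesis
  proof (rule val_eqI)
    show "feasible_flow ?N ts x y"
      unfolding ff by (auto simp: x_def y_def mp)
    show "flow_value ?N ts x = 3"
      unfolding fv by (simp add: x_def)
  next
    fix x y assume "feasible_flow ?N ts x y"
    then show "flow_value ?N ts x \<le> 3"
      unfolding ff fv by (simp add: mp insert_Diff_if)
  qed
qed

lemma val_outage_start_between:
  assumes t: "0 < t" "t < 1" and ts: "ts 0 = t" "ts 2 = 0"
  shows "val outage_instance ts = min (3 + 2 * t) (5 - 2 * t)"
proof -
  let ?N = outage_instance
  have bp: "break_points ?N ts = set [0, t, 1, 1 + t, 2]"
    using ts by (auto simp: break_points_def)
  have np: "num_periods ?N ts = 4" and bt: "break_time ?N ts = (!) [0, t, 1, 1 + t, 2]"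
    using periods_of_sorted_break_points[OF bp] t by simp_all
  have mp: "maint_periods ?N ts 0 = {2, 3}" "maint_periods ?N ts 2 = {1, 2}"
    using t ts unfolding maint_periods_def np bt atLeastAtMost_1_2_4 by auto
  note ff = feasible_flow_def Let_def np bt atLeastAtMost_1_2_4
  note fv = flow_value_def np atLeastAtMost_1_2_4
  \<comment> \<open>\<open>m\<close> is stored when the outage starts, and \<open>q\<close> of it is used up to time 1.\<close>
  define m where "m = min (4 * t) 2"
  define q where "q = min t (1 - t)"
  \<comment> \<open>In period 1 the amount \<open>t\<close> passes straight through and
    \<open>m\<close> is stored. Period 3 empties the store, and period 4 runs both outgoing arcs at
    full capacity.\<close>
  define x :: "nat \<Rightarrow> nat \<Rightarrow> real" where
    "x = (\<lambda>a. (!) ([[0, t + m, 0, 0, 3 * (1 - t)],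
                     [0, t, q, (m - q) / 3, 1 - t],
                     [0, 0, 0, 2 * (m - q) / 3, 2 * (1 - t)]] ! a))"
  define y :: "nat \<Rightarrow> nat \<Rightarrow> real" where "y = (\<lambda>_. (!) [0, m, m - q, 0, 0])"
  \<comment> \<open>These are the capacity bounds: \<open>m - q \<le> 3 * t\<close> lets period 3
    drain the store, and \<open>m \<le> 4 * t\<close> is the inflow capacity \<open>5 * t\<close>
    less the amount passing through.\<close>
  have mq: "0 \<le> q" "q \<le> m" "q \<le> 1 - t" "m - q \<le> 3 * t" "m \<le> 4 * t" "m \<le> 2"
    using t by (auto simp: m_def q_def min_def)
  show ?thesis
  proof (rule val_eqI)
    show "feasible_flow ?N ts x y"
      unfolding ff using t mq by (auto simp: x_def y_def mp field_simps)
    show "flow_value ?N ts x = min (3 + 2 * t) (5 - 2 * t)"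
      unfolding fv by (auto simp: x_def m_def min_def)
  next
    fix x y assume "feasible_flow ?N ts x y"
    \<comment> \<open>Only periods 1 and 4 admit inflow. The store must end empty, so period 4 takes
      in at most \<open>3 * (1 - t)\<close>; period 1 takes in at most \<open>5 * t\<close> and at
      most \<open>t + 2\<close>.\<close>
    then show "flow_value ?N ts x \<le> min (3 + 2 * t) (5 - 2 * t)"
      unfolding ff fv by (simp add: mp insert_Diff_if)
  qed
qed

lemma val_outage_instance:
  assumes "ts \<in> start_vectors outage_instance"
  shows "val outage_instance ts = min (3 + 2 * ts 0) (5 - 2 * ts 0)"
proof -
  have "0 \<le> ts 0" "ts 0 \<le> 1" "ts 2 = 0"
    using assms by (simp_all add: start_vectors_outage_instance)
  then consider "ts 0 = 0" | "ts 0 = 1" | "0 < ts 0" "ts 0 < 1"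
    by linarith
  then show ?thesis
    using val_outage_start_0 val_outage_start_1 val_outage_start_between \<open>ts 2 = 0\<close>
    by cases auto
qed

lemma ex_start_vector_half: "\<exists>ts \<in> start_vectors outage_instance. ts 0 = 1 / 2"
  by (rule bexI[of _ "\<lambda>a\<in>{0, 2}. if a = 0 then 1 / 2 else 0"])
    (auto simp: start_vectors_outage_instance)

text \<open>The two lines cross at 1/2 with value 4, and any other start gives less;
  \<open>ex_start_vector_half\<close> supplies the competitor that rules those out.\<close>

lemma optimal_solution_outage_instance:
  "optimal_solution outage_instance ts \<longleftrightarrow>
     ts \<in> start_vectors outage_instance \<and> ts 0 = 1 / 2"
  using ex_start_vector_half
  by (force simp: optimal_solution_def val_outage_instance min_def split: if_splits)

theorem mainTheorem3:
  shows "\<exists>N :: (nat, nat) maint_instance.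
           maintenance_problem N \<and> storage N \<noteq> {} \<and> integer_data N \<and>
           (\<exists>ts. optimal_solution N ts) \<and>
           \<not> (\<exists>ts. optimal_solution N ts \<and> integral_solution N ts)"
proof (intro exI[of _ outage_instance] conjI)
  show "\<exists>ts. optimal_solution outage_instance ts"
    using ex_start_vector_half by (auto simp: optimal_solution_outage_instance)
  have "(1 / 2 :: real) \<notin> \<int>"
    by (auto elim!: Ints_cases simp: field_simps)
  then show "\<not> (\<exists>ts. optimal_solution outage_instance ts \<and> integral_solution outage_instance ts)"
    by (metis optimal_solution_outage_instance integral_solution_def outage_instance_sel(11) insertI1)
qed (simp_all add: maintenance_problem_outage_instance integer_data_outage_instance)

end
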